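(* Let $a,b,r,s$ be nonzero real numbers. For every positive integer $i$, \[ \psi^{r,s}_{i}(x)=i\sum_{m=0}^{\lfloor i/2\rfloor}\frac{s^m\left(\frac{r}{a}\right)^{i-2m}\binom{i-m}{m}}{i-m}\ {}_2F_1\!\left(-m,\,i-m;\,i-2m+2;\,\frac{b\,r^2}{a^2 s}\right)\phi^{a,b}_{i-2m}(x). \]
   Context: For nonzero reals $a,b$, the generalized Fibonacci polynomials are defined by $\phi^{a,b}_0(x)=1$, $\phi^{a,b}_1(x)=ax$, $\phi^{a,b}_j(x)=ax\,\phi^{a,b}_{j-1}(x)+b\,\phi^{a,b}_{j-2}(x)$ for $j\ge2$. For nonzero reals $r,s$, the generalized Lucas polynomials are defined by $\psi^{r,s}_0(x)=2$, $\psi^{r,s}_1(x)=rx$, $\psi^{r,s}_j(x)=rx\,\psi^{r,s}_{j-1}(x)+s\,\psi^{r,s}_{j-2}(x)$ for $j\ge2$. For a non-negative integer $m$, ${}_2F_1(-m,\beta;\gamma;z)=\sum_{k=0}^{m}\frac{(-m)_k(\beta)_k}{(\gamma)_k}\frac{z^k}{k!}$ with $(u)_k=u(u+1)\cdots(u+k-1)$, $(u)_0=1$. *)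

theory Defs
  imports Complex_Main "HOL-Computational_Algebra.Polynomial"
begin

fun gen_fib_poly :: "real \<Rightarrow> real \<Rightarrow> nat \<Rightarrow> real poly" where
  "gen_fib_poly a b 0 = 1"
| "gen_fib_poly a b (Suc 0) = [:0, a:]"
| "gen_fib_poly a b (Suc (Suc j)) =
     [:0, a:] * gen_fib_poly a b (Suc j) + smult b (gen_fib_poly a b j)"

fun gen_lucas_poly :: "real \<Rightarrow> real \<Rightarrow> nat \<Rightarrow> real poly" where
  "gen_lucas_poly r s 0 = 2"
| "gen_lucas_poly r s (Suc 0) = [:0, r:]"
| "gen_lucas_poly r s (Suc (Suc j)) =
     [:0, r:] * gen_lucas_poly r s (Suc j) + smult s (gen_lucas_poly r s j)"

text \<open>The terminating Gauss series with upper parameters \<open>-m\<close> and \<open>\<beta>\<close>,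
  lower parameter \<open>\<gamma>\<close> and argument \<open>z\<close>; the natural number \<open>m\<close> itself is passed.\<close>

definition hyp2F1_neg :: "nat \<Rightarrow> real \<Rightarrow> real \<Rightarrow> real \<Rightarrow> real" where
  "hyp2F1_neg m \<beta> \<gamma> z =
     (\<Sum>k=0..m. pochhammer (- real m) k * pochhammer \<beta> k / pochhammer \<gamma> k * (z ^ k / fact k))"

end

theory Submission
  imports Defs
begin

text \<open>Write \<open>y = a x\<close>. The three-term recurrence reads \<open>y \<phi>\<^sub>j = \<phi>\<^sub>j\<^sub>+\<^sub>1 - b \<phi>\<^sub>j\<^sub>-\<^sub>1\<close>, so iterating it expands
  \<open>y\<^sup>n\<close> in the \<open>\<phi>\<^sub>n\<^sub>-\<^sub>2\<^sub>k\<close> with coefficients \<open>(- b)\<^sup>k\<close> times the ballot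
  numbers \<open>(n choose k) - (n choose (k - 1))\<close>.
  Substituting this into the explicit power expansion of \<open>\<psi>\<^sub>i\<close> and collecting the terms
  \<open>(j, k)\<close> with \<open>j + k = m\<close> gives a coefficient of \<open>\<phi>\<^sub>i\<^sub>-\<^sub>2\<^sub>m\<close> that is termwise, in \<open>k\<close>, the stated
  hypergeometric sum.\<close>

section \<open>Ballot numbers and powers in the generalized Fibonacci basis\<close>

text \<open>The case split encodes \<open>n choose (-1) = 0\<close>; truncated \<open>k - 1\<close>
  would give the wrong value at \<open>k = 0\<close>.\<close>

definition ballot :: "nat \<Rightarrow> nat \<Rightarrow> real" where
  "ballot n k = real (n choose k) - (case k of 0 \<Rightarrow> 0 | Suc l \<Rightarrow> real (n choose l))"

lemma ballot_0 [simp]: "ballot n 0 = 1"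
  by (simp add: ballot_def)

lemma ballot_Suc_Suc: "ballot (Suc n) (Suc k) = ballot n (Suc k) + ballot n k"
  by (cases k) (simp_all add: ballot_def)

text \<open>By symmetry of the binomials. This kills the boundary term at which truncated indices
  would break the recurrence for \<open>F\<close>.\<close>

lemma ballot_middle: "n + 1 = 2 * k \<Longrightarrow> ballot n k = 0"
proof (cases k)
  case (Suc l)
  moreover assume "n + 1 = 2 * k"
  ultimately have "n = Suc (2 * l)" by simp
  then have "n choose Suc l = n choose l"
    using binomial_symmetric[of l n] by simp
  then show ?thesis by (simp add: ballot_def Suc)
qed simp

text \<open>Over the common denominator \<open>fact k * fact (p + k + 1)\<close> the two binomials
  differ by the factor \<open>(p + k + 1) - k = p + 1\<close>.\<close>

lemma ballot_fact:
  "ballot (p + 2 * k) k = (real p + 1) * fact (p + 2 * k) / (fact k * fact (p + k + 1))"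
proof (cases k)
  case (Suc l)
  have 1: "real ((p + 2 * k) choose k) = fact (p + 2 * k) / (fact k * fact (p + k))"
    by (subst binomial_fact) (simp_all add: mult_2)
  have 2: "real ((p + 2 * k) choose l) = fact (p + 2 * k) / (fact l * fact (p + k + 1))"
  proof -
    have "p + 2 * k - l = p + k + 1" "l \<le> p + 2 * k" using Suc by linarith+
    then show ?thesis by (simp only: binomial_fact)
  qed
  have "ballot (p + 2 * k) k = fact (p + 2 * k) / (fact k * fact (p + k))
      - fact (p + 2 * k) / (fact l * fact (p + k + 1))"
    using 1 2 by (simp add: ballot_def Suc)
  also have "\<dots> = fact (p + 2 * k) / (fact k * fact (p + k + 1)) * (real (p + k + 1) - real k)"
  proof -
    have *: "(fact k :: real) = real k * fact l" "(fact (p + k + 1) :: real) = real (p + k + 1) * fact (p + k)"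
      by (simp_all add: Suc)
    have "real k \<noteq> 0" "real (p + k + 1) \<noteq> 0" by (simp_all add: Suc)
    then show ?thesis unfolding * by (simp add: divide_simps) (simp add: algebra_simps)
  qed
  finally show ?thesis by simp
qed simp

text \<open>In the next lemma \<open>F\<close> stands for \<open>\<phi>\<close> shifted by one index, so that \<open>F 0 = \<phi>\<^sub>-\<^sub>1 = 0\<close> and
  truncated subtraction makes all terms beyond \<open>2 k = n\<close> vanish.\<close>

lemma power_ballot_expansion:
  fixes F :: "nat \<Rightarrow> real"
  assumes F: "F 0 = 0" "F 1 = 1" "\<And>n. F (Suc (Suc n)) = y * F (Suc n) + b * F n"
  shows "y ^ n = (\<Sum>k\<le>n. (- b) ^ k * ballot n k * F (n + 1 - 2 * k))"
proof (induction n)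
  case (Suc n)
  have step: "ballot n k * (y * F (n + 1 - 2 * k)) = ballot n k * (F (n + 2 - 2 * k) - b * F (n - 2 * k))"
    for k
  proof -
    \<comment> \<open>In the first case the recurrence applies, in the second the ballot number is
      0, in the third every index is truncated to 0 and \<open>F 0 = 0\<close>.\<close>
    consider "2 * k \<le> n" | "n + 1 = 2 * k" | "n + 2 \<le> 2 * k" by linarith
    then show ?thesis
    proof cases
      case 1
      then have "n + 1 - 2 * k = Suc (n - 2 * k)" "n + 2 - 2 * k = Suc (Suc (n - 2 * k))" by simp_all
      then show ?thesis by (simp add: F(3))
    qed (simp_all add: ballot_middle F(1))
  qed
  have "y ^ Suc n = (\<Sum>k\<le>n. (- b) ^ k * (ballot n k * (y * F (n + 1 - 2 * k))))"
    unfolding power_Suc Suc.IH by (simp add: sum_distrib_left mult_ac)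
  also have "\<dots> = (\<Sum>k\<le>n. (- b) ^ k * ballot n k * F (n + 2 - 2 * k))
      + (\<Sum>k\<le>n. (- b) ^ Suc k * ballot n k * F (n - 2 * k))"
    unfolding step by (simp add: sum.distrib[symmetric] algebra_simps)
  \<comment> \<open>The added term \<open>k = n + 1\<close> has index 0. Splitting off
    \<open>k = 0\<close> then aligns both sums for the Pascal rule
    \<open>ballot_Suc_Suc\<close>.\<close>
  also have "(\<Sum>k\<le>n. (- b) ^ k * ballot n k * F (n + 2 - 2 * k))
      = (\<Sum>k\<le>Suc n. (- b) ^ k * ballot n k * F (n + 2 - 2 * k))"
    by (simp add: F(1))
  also have "\<dots> = F (n + 2) + (\<Sum>k\<le>n. (- b) ^ Suc k * ballot n (Suc k) * F (n - 2 * k))"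
    by (subst sum.atMost_Suc_shift) simp
  also have "\<dots> + (\<Sum>k\<le>n. (- b) ^ Suc k * ballot n k * F (n - 2 * k))
      = F (n + 2) + (\<Sum>k\<le>n. (- b) ^ Suc k * ballot (Suc n) (Suc k) * F (n - 2 * k))"
    by (simp add: ballot_Suc_Suc sum.distrib[symmetric] algebra_simps)
  also have "\<dots> = (\<Sum>k\<le>Suc n. (- b) ^ k * ballot (Suc n) k * F (Suc n + 1 - 2 * k))"
    by (subst sum.atMost_Suc_shift) simp
  finally show ?case .
qed (simp add: F(2)[simplified])

lemma power_gen_fib_expansion:
  "(a * x) ^ n =
    (\<Sum>k\<le>n div 2. (- b) ^ k * ballot n k * poly (gen_fib_poly a b (n - 2 * k)) x)"
proof -
  define F where "F = case_nat 0 (\<lambda>m. poly (gen_fib_poly a b m) x)"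
  have "F (Suc (Suc n)) = (a * x) * F (Suc n) + b * F n" for n
    by (cases n) (simp_all add: F_def algebra_simps)
  then have "(a * x) ^ n = (\<Sum>k\<le>n. (- b) ^ k * ballot n k * F (n + 1 - 2 * k))"
    by (intro power_ballot_expansion) (simp_all add: F_def)
  also have "\<dots> = (\<Sum>k\<le>n div 2. (- b) ^ k * ballot n k * F (n + 1 - 2 * k))"
    by (rule sum.mono_neutral_right) (auto simp: F_def not_le split: nat.split)
  also have "\<dots> = (\<Sum>k\<le>n div 2. (- b) ^ k * ballot n k * poly (gen_fib_poly a b (n - 2 * k)) x)"
  proof (rule sum.cong[OF refl])
    fix k assume "k \<in> {..n div 2}"
    then have "n + 1 - 2 * k = Suc (n - 2 * k)" by auto
    then show "(- b) ^ k * ballot n k * F (n + 1 - 2 * k) =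
        (- b) ^ k * ballot n k * poly (gen_fib_poly a b (n - 2 * k)) x"
      by (simp add: F_def)
  qed
  finally show ?thesis .
qed

section \<open>Explicit power expansions of both families\<close>

text \<open>Pascal's rule matches the recurrence. Terms with \<open>2 * j > n\<close> have zero
  binomial, so the range up to \<open>n\<close> is harmless and eases index shifts.\<close>

lemma poly_gen_fib_explicit:
  "poly (gen_fib_poly r s n) x = (\<Sum>j\<le>n. real ((n - j) choose j) * s ^ j * (r * x) ^ (n - 2 * j))"
proof (induction r s n rule: gen_fib_poly.induct)
  case (3 r s n)
  define y where "y = r * x"
  \<comment> \<open>Once the exponent is truncated, the powers of \<open>y\<close> may disagree, but
    the binomial is then 0.\<close>
  have step: "real ((Suc n - j) choose j) * (y * y ^ (Suc n - 2 * j)) =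
      real ((Suc n - j) choose j) * y ^ (n + 2 - 2 * j)" for j
  proof (cases "2 * j \<le> Suc n")
    case True
    then have "n + 2 - 2 * j = Suc (Suc n - 2 * j)" by simp
    then show ?thesis by simp
  qed (simp add: binomial_eq_0)
  have "poly (gen_fib_poly r s (Suc (Suc n))) x =
      (\<Sum>j\<le>Suc n. s ^ j * (real ((Suc n - j) choose j) * (y * y ^ (Suc n - 2 * j))))
      + (\<Sum>j\<le>n. real ((n - j) choose j) * s ^ Suc j * y ^ (n - 2 * j))"
    using 3 by (simp add: y_def sum_distrib_left algebra_simps del: sum.atMost_Suc)
  also have "(\<Sum>j\<le>Suc n. s ^ j * (real ((Suc n - j) choose j) * (y * y ^ (Suc n - 2 * j))))
      = y ^ (n + 2) + (\<Sum>j\<le>n. real ((n - j) choose Suc j) * s ^ Suc j * y ^ (n - 2 * j))"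
    unfolding step by (subst sum.atMost_Suc_shift) (simp add: mult_ac)
  also have "\<dots> + (\<Sum>j\<le>n. real ((n - j) choose j) * s ^ Suc j * y ^ (n - 2 * j))
      = y ^ (n + 2) + (\<Sum>j\<le>n. real ((Suc n - j) choose Suc j) * s ^ Suc j * y ^ (n - 2 * j))"
    by (simp add: sum.distrib[symmetric] algebra_simps Suc_diff_le)
  also have "\<dots> = (\<Sum>j\<le>Suc (Suc n). real ((Suc (Suc n) - j) choose j) * s ^ j * y ^ (Suc (Suc n) - 2 * j))"
    by (subst sum.atMost_Suc_shift) simp
  finally show ?case by (simp only: y_def)
qed simp_all

text \<open>Both sides obey the same recurrence in \<open>n\<close>, so agreement at
  \<open>n = 0\<close> and \<open>n = 1\<close> suffices.\<close>

lemma gen_lucas_eq_gen_fib: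
  "gen_lucas_poly r s (Suc (Suc n)) = gen_fib_poly r s (Suc (Suc n)) + smult s (gen_fib_poly r s n)"
proof (induction r s n rule: gen_fib_poly.induct)
  case (1 r s)
  show ?case by (simp add: numeral_poly)
next
  case (2 r s)
  show ?case by (simp add: numeral_poly)
next
  case (3 r s n)
  show ?case
    unfolding gen_lucas_poly.simps(3)[of r s "Suc (Suc n)"] 3
    by (simp add: algebra_simps smult_add_right)
qed

text \<open>With \<open>n - Suc j = q + 1\<close>, absorption turns the second binomial into
  \<open>(j + 1) / (q + 1)\<close> times the first, and
  \<open>(q + 1) + (j + 1) = n\<close>.\<close>

lemma binomial_lucas:
  assumes "2 * Suc j \<le> n"
  shows "real ((n - Suc j) choose Suc j) + real ((n - Suc (Suc j)) choose j) =
    real n * real ((n - Suc j) choose Suc j) / real (n - Suc j)"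
proof -
  obtain q where q: "n - Suc j = Suc q" "n = q + j + 2"
    using assms by (auto intro!: that[of "n - j - 2"])
  have "real (Suc j) * real (Suc q choose Suc j) = real (Suc q) * real (q choose j)"
    by (metis Suc_times_binomial_eq mult.commute of_nat_mult)
  moreover have "n - Suc (Suc j) = q" using q by simp
  ultimately show ?thesis
    unfolding q(1) by (simp add: q(2) divide_simps del: binomial_Suc_Suc) (simp add: algebra_simps)
qed

lemma poly_gen_lucas_explicit:
  assumes "i > 0"
  shows "poly (gen_lucas_poly r s i) x =
    (\<Sum>j\<le>i div 2. real i * real ((i - j) choose j) / real (i - j) * s ^ j * (r * x) ^ (i - 2 * j))"
proof (cases "i = 1")
  case False
  with assms obtain n where i: "i = Suc (Suc n)"
    by (metis One_nat_def gr0_implies_Suc not_gr_zero)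
  define y where "y = r * x"
  have "poly (gen_lucas_poly r s i) x =
      (\<Sum>j\<le>Suc n. real ((i - j) choose j) * s ^ j * y ^ (i - 2 * j))
      + (\<Sum>j\<le>n. real ((n - j) choose j) * s ^ Suc j * y ^ (n - 2 * j))"
    unfolding i gen_lucas_eq_gen_fib poly_add poly_smult poly_gen_fib_explicit y_def[symmetric]
    by (simp add: sum_distrib_left algebra_simps)
  also have "\<dots> = y ^ i + (\<Sum>j\<le>n. (real ((i - Suc j) choose Suc j) + real ((i - Suc (Suc j)) choose j))
        * s ^ Suc j * y ^ (i - 2 * Suc j))"
    by (subst sum.atMost_Suc_shift) (simp add: i sum.distrib[symmetric] algebra_simps)
  \<comment> \<open>Both binomials vanish beyond \<open>n div 2\<close>; the cut secures the
    hypothesis of \<open>binomial_lucas\<close>.\<close>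
  also have "\<dots> = y ^ i + (\<Sum>j\<le>n div 2. (real ((i - Suc j) choose Suc j) + real ((i - Suc (Suc j)) choose j))
        * s ^ Suc j * y ^ (i - 2 * Suc j))"
    by (intro arg_cong[where f = "(+) _"] sum.mono_neutral_right) (auto simp: i binomial_eq_0)
  also have "\<dots> = y ^ i + (\<Sum>j\<le>n div 2. real i * real ((i - Suc j) choose Suc j) / real (i - Suc j)
        * s ^ Suc j * y ^ (i - 2 * Suc j))"
    by (intro arg_cong[where f = "(+) _"] sum.cong refl, subst binomial_lucas) (auto simp: i)
  also have "\<dots> = (\<Sum>j\<le>Suc (n div 2). real i * real ((i - j) choose j) / real (i - j)
        * s ^ j * y ^ (i - 2 * j))"
    by (subst sum.atMost_Suc_shift) (use assms in simp)
  finally show ?thesis by (simp add: y_def i)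
qed simp

section \<open>The hypergeometric coefficient\<close>

text \<open>All Pochhammer symbols are factorial quotients. With \<open>q + 1 = p + j + k\<close>,
  both sides become \<open>(- 1) ^ k * (p + 1) * fact (q + k) / (fact j * fact k * fact (p + k +
  1))\<close>.\<close>

lemma hypergeometric_term:
  fixes p j k :: nat
  assumes "p + j + k > 0"
  defines "m \<equiv> j + k"
  shows "real ((p + m) choose m) / real (p + m) *
      (pochhammer (- real m) k * pochhammer (real (p + m)) k / pochhammer (real (p + 2)) k / fact k) =
    real ((p + 2 * k + j) choose j) / real (p + 2 * k + j) * (- 1) ^ k * ballot (p + 2 * k) k"
proof -
  obtain q where q: "p + j + k = Suc q" using assms(1) gr0_implies_Suc by blast
  have poch: "pochhammer (real (Suc u)) k = fact (u + k) / fact u" for u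
    using pochhammer_product'[of "1 :: real" u k] by (simp add: pochhammer_fact[symmetric] field_simps)
  have p1: "pochhammer (- real m) k = (- 1) ^ k * (fact m / fact j)"
    using pochhammer_minus[of "real m" k] poch[of j] by (simp add: m_def add.commute)
  have p2: "pochhammer (real (p + m)) k = fact (q + k) / fact q"
    using poch[of q] q by (simp add: m_def add.assoc[symmetric])
  have p3: "pochhammer (real (p + 2)) k = fact (p + k + 1) / fact (p + 1)"
    using poch[of "p + 1"] by (simp add: add_ac)
  have b1: "real ((p + m) choose m) / real (p + m) = fact q / (fact m * fact p)"
  proof -
    have "p + m = Suc q" using q by (simp add: m_def)
    moreover have "real ((p + m) choose m) = fact (p + m) / (fact m * fact p)"
      by (subst binomial_fact) simp_all
    ultimately show ?thesis by simp
  qed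
  have b2: "real ((p + 2 * k + j) choose j) / real (p + 2 * k + j) = fact (q + k) / (fact j * fact (p + 2 * k))"
  proof -
    have "p + 2 * k + j = Suc (q + k)" using q by simp
    moreover have "real ((p + 2 * k + j) choose j) = fact (p + 2 * k + j) / (fact j * fact (p + 2 * k))"
      by (subst binomial_fact) simp_all
    ultimately show ?thesis by (simp only: fact_Suc) (simp del: of_nat_Suc)
  qed
  have f: "(fact (p + 1) :: real) = (real p + 1) * fact p" by simp
  show ?thesis
    unfolding p1 p2 p3 b1 b2 ballot_fact f by (simp add: field_simps del: fact_Suc)
qed

text \<open>The left side is the total coefficient of \<open>gen_fib_poly a b (i - 2 * m)\<close>
  along the diagonal \<open>j + k = m\<close>; the sums agree term by term in
  \<open>k\<close>.\<close>

lemma lucas_fib_coefficient: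
  fixes a b r s :: real
  assumes "a \<noteq> 0" "s \<noteq> 0" "i > 0" "2 * m \<le> i"
  shows "(\<Sum>k\<le>m. real i * real ((i - (m - k)) choose (m - k)) / real (i - (m - k)) * s ^ (m - k)
        * (r / a) ^ (i - 2 * (m - k)) * ((- b) ^ k * ballot (i - 2 * (m - k)) k)) =
    real i * (s ^ m * (r / a) ^ (i - 2 * m) * real ((i - m) choose m) / real (i - m)
      * hyp2F1_neg m (real (i - m)) (real (i - 2 * m + 2)) (b * r\<^sup>2 / (a\<^sup>2 * s)))"
proof -
  define p where "p = i - 2 * m"
  define z where "z = b * r\<^sup>2 / (a\<^sup>2 * s)"
  have i: "i = p + 2 * m" using assms(4) by (simp add: p_def)
  have "real i * real ((i - (m - k)) choose (m - k)) / real (i - (m - k)) * s ^ (m - k)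
        * (r / a) ^ (i - 2 * (m - k)) * ((- b) ^ k * ballot (i - 2 * (m - k)) k) =
      real i * (s ^ m * (r / a) ^ p * real ((i - m) choose m) / real (i - m)
        * (pochhammer (- real m) k * pochhammer (real (i - m)) k / pochhammer (real (p + 2)) k
            * (z ^ k / fact k)))"
    (is "?L = ?R") if "k \<le> m" for k
  proof -
    define j where "j = m - k"
    have m: "m = j + k" using that by (simp add: j_def)
    have idx: "m - k = j" "i - j = p + 2 * k + j" "i - 2 * j = p + 2 * k" "i - m = p + m"
      using i m by linarith+
    \<comment> \<open>Since \<open>s * z = (r / a)\<^sup>2 * b\<close>, the factor
      \<open>z ^ k\<close> trades \<open>k\<close> factors \<open>s\<close> for \<open>2 * k\<close>
      factors \<open>r / a\<close> and \<open>k\<close> factors \<open>b\<close>.\<close>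
    have zk: "s ^ m * (r / a) ^ p * z ^ k = s ^ j * (r / a) ^ (p + 2 * k) * b ^ k"
    proof -
      have "s * z = (r / a)\<^sup>2 * b"
        using assms by (simp add: z_def power_divide)
      then have "s ^ k * z ^ k = (r / a) ^ (2 * k) * b ^ k"
        by (simp only: power_mult power_mult_distrib[symmetric])
      then show ?thesis by (simp add: m power_add mult_ac)
    qed
    have "?R = real i * (s ^ m * (r / a) ^ p * z ^ k) * (real ((p + m) choose m) / real (p + m) *
      (pochhammer (- real m) k * pochhammer (real (p + m)) k / pochhammer (real (p + 2)) k / fact k))"
      unfolding idx by simp
    also have "\<dots> = real i * (s ^ j * (r / a) ^ (p + 2 * k) * b ^ k) *
        (real ((p + 2 * k + j) choose j) / real (p + 2 * k + j) * (- 1) ^ k * ballot (p + 2 * k) k)"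
      using hypergeometric_term[of p j k] assms(3) unfolding zk by (simp add: i m)
    also have "\<dots> = ?L"
      unfolding idx power_minus[of b] by simp
    finally show ?thesis by simp
  qed
  then show ?thesis
    unfolding hyp2F1_neg_def p_def[symmetric] z_def[symmetric]
    by (simp add: sum_distrib_left atMost_atLeast0)
qed

section \<open>Reordering the double sum\<close>

theorem theorem2:
  fixes a b r s :: real and i :: nat
  assumes "a \<noteq> 0" and "b \<noteq> 0" and "r \<noteq> 0" and "s \<noteq> 0" and "i > 0"
  shows "gen_lucas_poly r s i =
    smult (real i)
      (\<Sum>m=0..i div 2.
         smult (s ^ m * (r / a) ^ (i - 2 * m) * real ((i - m) choose m) / real (i - m)
                * hyp2F1_neg m (real (i - m)) (real (i - 2 * m + 2)) (b * r\<^sup>2 / (a\<^sup>2 * s)))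
           (gen_fib_poly a b (i - 2 * m)))"
proof (rule poly_eq_poly_eq_iff[THEN iffD1], rule ext)
  fix x :: real
  define N where "N = i div 2"
  define lc where "lc j = real i * real ((i - j) choose j) / real (i - j) * s ^ j * (r / a) ^ (i - 2 * j)" for j
  define f where "f n = poly (gen_fib_poly a b n) x" for n
  define g where "g j k = lc j * ((- b) ^ k * ballot (i - 2 * j) k) * f (i - 2 * (j + k))" for j k
  have "poly (gen_lucas_poly r s i) x = (\<Sum>j\<le>N. lc j * (a * x) ^ (i - 2 * j))"
  proof -
    \<comment> \<open>Rescaling to powers of \<open>a * x\<close> makes
      \<open>power_gen_fib_expansion\<close> applicable.\<close>
    have "r * x = (r / a) * (a * x)" using assms by simp
    then show ?thesis
      unfolding poly_gen_lucas_explicit[OF assms(5)] lc_def N_def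
      by (simp only: power_mult_distrib mult.assoc)
  qed
  also have "\<dots> = (\<Sum>j\<le>N. \<Sum>k\<le>N - j. g j k)"
    unfolding power_gen_fib_expansion[of a x _ b] g_def f_def N_def
  proof (intro sum.cong refl)
    fix j
    \<comment> \<open>This makes the index set the triangle \<open>j + k \<le> N\<close>.\<close>
    have "(i - 2 * j) div 2 = i div 2 - j" by linarith
    then show "lc j * (\<Sum>k\<le>(i - 2 * j) div 2. (- b) ^ k * ballot (i - 2 * j) k
        * poly (gen_fib_poly a b (i - 2 * j - 2 * k)) x) =
      (\<Sum>k\<le>i div 2 - j. lc j * ((- b) ^ k * ballot (i - 2 * j) k)
        * poly (gen_fib_poly a b (i - 2 * (j + k))) x)"
      by (simp add: sum_distrib_left mult.assoc add_mult_distrib2)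
  qed
  also have "\<dots> = (\<Sum>(j, k)\<in>{(j, k). j + k \<le> N}. g j k)"
    by (subst sum.Sigma) (auto intro!: sum.cong)
  \<comment> \<open>The swap makes \<open>k\<close> the inner variable of the diagonal sums, as in
    the hypergeometric series.\<close>
  also have "\<dots> = (\<Sum>(k, j)\<in>{(k, j). k + j \<le> N}. g j k)"
    by (rule sum.reindex_bij_witness[where i = prod.swap and j = prod.swap]) auto
  also have "\<dots> = (\<Sum>m\<le>N. \<Sum>k\<le>m. g (m - k) k)"
    by (rule sum.triangle_reindex_eq)
  also have "\<dots> = (\<Sum>m\<le>N. (\<Sum>k\<le>m. lc (m - k) * ((- b) ^ k * ballot (i - 2 * (m - k)) k)) * f (i - 2 * m))"
    by (intro sum.cong refl) (simp add: g_def sum_distrib_right)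
  also have "\<dots> = (\<Sum>m\<le>N. real i * (s ^ m * (r / a) ^ (i - 2 * m) * real ((i - m) choose m) / real (i - m)
      * hyp2F1_neg m (real (i - m)) (real (i - 2 * m + 2)) (b * r\<^sup>2 / (a\<^sup>2 * s))) * f (i - 2 * m))"
    unfolding lc_def
    by (intro sum.cong refl, subst lucas_fib_coefficient) (use assms in \<open>auto simp: N_def\<close>)
  finally show "poly (gen_lucas_poly r s i) x = poly (smult (real i)
      (\<Sum>m=0..i div 2.
         smult (s ^ m * (r / a) ^ (i - 2 * m) * real ((i - m) choose m) / real (i - m)
                * hyp2F1_neg m (real (i - m)) (real (i - 2 * m + 2)) (b * r\<^sup>2 / (a\<^sup>2 * s)))
           (gen_fib_poly a b (i - 2 * m)))) x"
    by (simp add: poly_sum sum_distrib_left f_def N_def atMost_atLeast0 mult.assoc)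
qed

end
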